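(* Let $P$ be a locally compact Hausdorff space of class $\mathcal K_{\mathrm{IV}}$, let $\alpha P=P\cup\{p_\infty\}$ be its one-point compactification, and let $$K=\alpha P\times[0,\omega_0]\setminus\{(p_\infty,\omega_0)\},$$ where $[0,\omega_0]$ is the space of all ordinals $\le\omega_0$ (the first infinite ordinal) with the order topology. Then the unit ball of $C_0(K)$ (and hence the image of the unit ball under the identity operator $\mathrm{Id}:C_0(K)\to C_0(K)$) is $(C_b(K),C_0(K))$-totally bounded, but the identity operator is not $C_0(K)$-compact.
   Context: Class $\mathcal K_{\mathrm{IV}}$: a locally compact Hausdorff space $P$ such that for every $\sigma$-compact subset $S\subset P$ (countable union of compact sets) the complement $P\setminus S$ has nonempty interior in $P$ and the point at infinity is an interior point of $\alpha P\setminus S$; equivalently, $P$ is non-compact and every $\sigma$-compact subset of $P$ has compact closure in $P$. $C_0(K)$ (continuous functions vanishing at infinity) is a Hilbert module over itself with $\langle x,y\rangle=\overline{x}\,y$; $C_b(K)$ (bounded continuous functions) is its multiplier algebra and multiplier module. $\mathcal A$-compactness: for Hilbert $\mathcal A$-modules $\mathcal M,\mathcal N$, elementary operators are $\theta_{x,y}(z)=x\langle y,z\rangle$ with $x\in\mathcal N$, $y\in\mathcal M$; the $\mathcal A$-compact operators $\mathcal M\to\mathcal N$ are the operator-norm closure of the linear span of these. $(C_b(K),C_0(K))$-total boundedness: a countable system $X=\{x_i\}\subset C_b(K)$ is (outer) $C_0(K)$-admissible if for every $x\in C_0(K)$ the series $\sum_i\langle x,x_i\rangle\langle x_i,x\rangle$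 converges in norm, its sum is $\le\langle x,x\rangle$, and $\|x_i\|\le1$ for all $i$. For such $X$ and a countable collection $\Phi=\{\varphi_1,\varphi_2,\dots\}$ of states on $C_0(K)$ (positive linear functionals of norm $1$), put $d_{X,\Phi}(x,y)^2=\sup_k\sum_{i=k}^\infty|\varphi_k(\langle x-y,x_i\rangle)|^2$ for $x,y\in C_0(K)$. A set $Y\subset C_0(K)$ is $(C_b(K),C_0(K))$-totally bounded if for every such pair $(X,\Phi)$ and every $\varepsilon>0$ there are finitely many $y_1,\dots,y_n\in Y$ such that the sets $\{y\in Y: d_{X,\Phi}(y_i,y)<\varepsilon\}$ cover $Y$. *)

theory Defs
  imports "HOL-Analysis.Analysis"
begin

definition sigma_compactin :: "'a topology \<Rightarrow> 'a set \<Rightarrow> bool" where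
  "sigma_compactin X S \<longleftrightarrow> (\<exists>\<C>. countable \<C> \<and> (\<forall>C\<in>\<C>. compactin X C) \<and> S = \<Union>\<C>)"

text \<open>In the library's one-point compactification, \<^term>\<open>None\<close> is the point at infinity and
  \<^term>\<open>Some\<close> embeds \<open>P\<close>.\<close>

definition class_K_IV :: "'p topology \<Rightarrow> bool" where
  "class_K_IV P \<longleftrightarrow>
     locally_compact_space P \<and> Hausdorff_space P \<and>
     (\<forall>S. sigma_compactin P S \<longrightarrow>
        P interior_of (topspace P - S) \<noteq> {} \<and>
        None \<in> Alexandroff_compactification P interior_of
                 (topspace (Alexandroff_compactification P) - Some ` S))"

text \<open>The ordinal space \<open>[0, \<omega>\<^sub>0]\<close> is the type \<^typ>\<open>enat\<close>, whose library topology is the order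
  topology, with \<open>\<infinity>\<close> in the role of \<open>\<omega>\<^sub>0\<close>.\<close>

definition corner_space :: "'p topology \<Rightarrow> ('p option \<times> enat) topology" where
  "corner_space P =
     (let Q = prod_topology (Alexandroff_compactification P) (euclidean :: enat topology)
      in subtopology Q (topspace Q - {(None, \<infinity>)}))"

text \<open>A function on the space \<open>K\<close> is represented by its extension by \<open>0\<close> to the whole type, so that
  equality of elements of \<open>C\<^sub>b(K)\<close> is equality in HOL.\<close>

definition Cb :: "'b topology \<Rightarrow> ('b \<Rightarrow> complex) set" where
  "Cb K = {f. continuous_map K euclidean f \<and> bounded (f ` topspace K) \<and>
              (\<forall>t. t \<notin> topspace K \<longrightarrow> f t = 0)}"

definition C0 :: "'b topology \<Rightarrow> ('b \<Rightarrow> complex) set" where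
  "C0 K = {f. continuous_map K euclidean f \<and>
              (\<forall>\<epsilon>>0. \<exists>C. compactin K C \<and> (\<forall>t\<in>topspace K - C. cmod (f t) < \<epsilon>)) \<and>
              (\<forall>t. t \<notin> topspace K \<longrightarrow> f t = 0)}"

definition supnorm :: "'b topology \<Rightarrow> ('b \<Rightarrow> complex) \<Rightarrow> real" where
  "supnorm K f = (SUP t\<in>topspace K. cmod (f t))"

definition C0_unit_ball :: "'b topology \<Rightarrow> ('b \<Rightarrow> complex) set" where
  "C0_unit_ball K = {f \<in> C0 K. supnorm K f \<le> 1}"

definition C0_nonneg :: "'b topology \<Rightarrow> ('b \<Rightarrow> complex) \<Rightarrow> bool" where
  "C0_nonneg K f \<longleftrightarrow> f \<in> C0 K \<and> (\<forall>t\<in>topspace K. f t \<in> \<real>\<^sub>\<ge>\<^sub>0)"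

definition ip :: "('b \<Rightarrow> complex) \<Rightarrow> ('b \<Rightarrow> complex) \<Rightarrow> 'b \<Rightarrow> complex" where
  "ip x y = (\<lambda>t. cnj (x t) * y t)"

subsection \<open>\<open>C\<^sub>0(K)\<close>-compact operators on the Hilbert module \<open>C\<^sub>0(K)\<close>\<close>

definition bounded_C0_op :: "'b topology \<Rightarrow> (('b \<Rightarrow> complex) \<Rightarrow> 'b \<Rightarrow> complex) \<Rightarrow> bool" where
  "bounded_C0_op K T \<longleftrightarrow>
     (\<forall>z\<in>C0 K. T z \<in> C0 K) \<and>
     (\<forall>z\<in>C0 K. \<forall>w\<in>C0 K. T (\<lambda>t. z t + w t) = (\<lambda>t. T z t + T w t)) \<and>
     (\<forall>c. \<forall>z\<in>C0 K. T (\<lambda>t. c * z t) = (\<lambda>t. c * T z t)) \<and>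
     (\<exists>B. \<forall>z\<in>C0 K. supnorm K (T z) \<le> B * supnorm K z)"

definition C0_opnorm :: "'b topology \<Rightarrow> (('b \<Rightarrow> complex) \<Rightarrow> 'b \<Rightarrow> complex) \<Rightarrow> real" where
  "C0_opnorm K T = (SUP z\<in>C0_unit_ball K. supnorm K (T z))"

definition elem_op ::
  "('b \<Rightarrow> complex) \<Rightarrow> ('b \<Rightarrow> complex) \<Rightarrow> ('b \<Rightarrow> complex) \<Rightarrow> 'b \<Rightarrow> complex" where
  "elem_op x y = (\<lambda>z t. x t * ip y z t)"

definition elem_op_span :: "'b topology \<Rightarrow> (('b \<Rightarrow> complex) \<Rightarrow> 'b \<Rightarrow> complex) set" where
  "elem_op_span K =
     {F. \<exists>(n::nat) (c :: nat \<Rightarrow> complex) x y. (\<forall>i<n. x i \<in> C0 K \<and> y i \<in> C0 K) \<and>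
           F = (\<lambda>z t. \<Sum>i<n. c i * elem_op (x i) (y i) z t)}"

definition C0_compact_op :: "'b topology \<Rightarrow> (('b \<Rightarrow> complex) \<Rightarrow> 'b \<Rightarrow> complex) \<Rightarrow> bool" where
  "C0_compact_op K T \<longleftrightarrow> bounded_C0_op K T \<and>
     (\<forall>\<epsilon>>0. \<exists>F\<in>elem_op_span K. C0_opnorm K (\<lambda>z t. T z t - F z t) < \<epsilon>)"

subsection \<open>\<open>(C\<^sub>b(K), C\<^sub>0(K))\<close>-total boundedness\<close>

text \<open>Countable systems are sequences indexed from \<open>0\<close>. A finite system \<open>X\<close> is covered by padding
  with \<open>0\<close>, and a finite family of states by repeating its last member; neither changes
  the pseudometric below.\<close>

definition C0_admissible :: "'b topology \<Rightarrow> (nat \<Rightarrow> 'b \<Rightarrow> complex) \<Rightarrow> bool" where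
  "C0_admissible K X \<longleftrightarrow>
     (\<forall>i. X i \<in> Cb K \<and> supnorm K (X i) \<le> 1) \<and>
     (\<forall>x\<in>C0 K. \<exists>s\<in>C0 K.
        (\<lambda>n. supnorm K (\<lambda>t. (\<Sum>i<n. ip x (X i) t * ip (X i) x t) - s t)) \<longlonglongrightarrow> 0 \<and>
        C0_nonneg K (\<lambda>t. ip x x t - s t))"

definition C0_state :: "'b topology \<Rightarrow> (('b \<Rightarrow> complex) \<Rightarrow> complex) \<Rightarrow> bool" where
  "C0_state K \<phi> \<longleftrightarrow>
     (\<forall>f\<in>C0 K. \<forall>g\<in>C0 K. \<phi> (\<lambda>t. f t + g t) = \<phi> f + \<phi> g) \<and>
     (\<forall>c. \<forall>f\<in>C0 K. \<phi> (\<lambda>t. c * f t) = c * \<phi> f) \<and>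
     (\<forall>f. C0_nonneg K f \<longrightarrow> \<phi> f \<in> \<real>\<^sub>\<ge>\<^sub>0) \<and>
     bdd_above ((\<lambda>f. cmod (\<phi> f)) ` C0_unit_ball K) \<and>
     (SUP f\<in>C0_unit_ball K. cmod (\<phi> f)) = 1"

text \<open>For admissible \<open>X\<close>, states \<open>\<Phi>\<close> and \<open>z = x - y\<close> in \<open>C\<^sub>0(K)\<close>, Cauchy--Schwarz bounds every partial
  sum by \<open>\<Phi> k (ip z z)\<close>, which is at most the square of the norm of \<open>z\<close>; so the series converge and
  the supremum is finite.\<close>

definition d_pm ::
  "(nat \<Rightarrow> 'b \<Rightarrow> complex) \<Rightarrow> (nat \<Rightarrow> ('b \<Rightarrow> complex) \<Rightarrow> complex) \<Rightarrow>
   ('b \<Rightarrow> complex) \<Rightarrow> ('b \<Rightarrow> complex) \<Rightarrow> real" where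
  "d_pm X \<Phi> x y =
     sqrt (SUP k. \<Sum>i. (cmod (\<Phi> k (ip (\<lambda>t. x t - y t) (X (k + i)))))\<^sup>2)"

definition Cb_C0_totally_bounded :: "'b topology \<Rightarrow> ('b \<Rightarrow> complex) set \<Rightarrow> bool" where
  "Cb_C0_totally_bounded K Y \<longleftrightarrow>
     (\<forall>X \<Phi>. C0_admissible K X \<longrightarrow> (\<forall>k. C0_state K (\<Phi> k)) \<longrightarrow>
        (\<forall>\<epsilon>>0. \<exists>F. finite F \<and> F \<subseteq> Y \<and> Y \<subseteq> (\<Union>f\<in>F. {y\<in>Y. d_pm X \<Phi> f y < \<epsilon>})))"

end

theory Submission
  imports Defs
begin

text \<open>For an admissible system \<open>X\<close> the series \<open>\<Sum> \<bar>X i\<bar>\<^sup>2\<close> converges uniformly on compact sets, and for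
  this \<open>K\<close> on all of \<open>K\<close>: outside a \<open>\<sigma>\<close>-compact subset of \<open>P\<close>, hence at some point \<open>p\<close>, the
  countably many functions \<open>X i (\<cdot>, n)\<close> with \<open>n < \<omega>\<^sub>0\<close> take their values at \<open>p\<^sub>\<infinity>\<close>, so a sequence of
  points of \<open>K\<close> witnessing non-uniformity can be moved into \<open>P \<times> [0, \<omega>\<^sub>0]\<close>, and a countable
  subset of \<open>P\<close> is relatively compact. With uniformly small tails \<^const>\<open>d_pm\<close> depends, up to \<open>\<epsilon>\<close>, on finitely
  many bounded functionals only. The identity is not compact because \<open>C\<^sub>0(K)\<close>-compact operators are limits of
  multiplications by elements of \<open>C\<^sub>0(K)\<close> and \<open>K\<close> is not compact.\<close>

section \<open>Function spaces\<close>

lemma continuous_map_mult_complex [continuous_intros]: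
  fixes f g :: "'b \<Rightarrow> complex"
  assumes "continuous_map K euclidean f" "continuous_map K euclidean g"
  shows "continuous_map K euclidean (\<lambda>t. f t * g t)"
  using assms by (simp add: continuous_map_atin tendsto_mult)

lemma continuous_map_cnj [continuous_intros]:
  assumes "continuous_map K euclidean f"
  shows "continuous_map K euclidean (\<lambda>t. cnj (f t))"
  using assms by (simp add: continuous_map_atin tendsto_cnj)

lemma C0_bounded:
  assumes "f \<in> C0 K"
  obtains B where "B > 0" "\<And>t. cmod (f t) \<le> B"
proof -
  have "(1 :: real) > 0" by simp
  then obtain C where C: "compactin K C" "\<And>t. t \<in> topspace K - C \<Longrightarrow> cmod (f t) < 1"
    using assms unfolding C0_def by blast
  have f: "continuous_map K euclidean f" "\<And>t. t \<notin> topspace K \<Longrightarrow> f t = 0"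
    using assms by (auto simp: C0_def)
  have "compact (f ` C)"
    using image_compactin[OF C(1) f(1)] by simp
  then obtain b where b: "\<And>t. t \<in> C \<Longrightarrow> cmod (f t) \<le> b"
    using compact_imp_bounded bounded_iff by (metis imageI)
  \<comment> \<open>b serves on C, 1 on the rest of K, and off K the function is 0, so the bound
    holds on the whole type.\<close>
  have "cmod (f t) \<le> max 1 b" for t
    using b[of t] C(2)[of t] f(2)[of t] by (cases "t \<in> C"; cases "t \<in> topspace K") force+
  then show ?thesis
    using that[of "max 1 b"] by simp
qed

lemma Cb_bounded:
  assumes "f \<in> Cb K"
  obtains B where "B > 0" "\<And>t. cmod (f t) \<le> B"
proof -
  obtain b where "\<And>t. t \<in> topspace K \<Longrightarrow> cmod (f t) \<le> b"
    using assms by (auto simp: Cb_def bounded_iff)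
  then have "cmod (f t) \<le> max 1 b" for t
    using assms by (cases "t \<in> topspace K") (force simp: Cb_def)+
  then show ?thesis
    using that[of "max 1 b"] by simp
qed

lemma C0_subset_Cb: "C0 K \<subseteq> Cb K"
proof
  fix f assume f: "f \<in> C0 K"
  then obtain B where "\<And>t. cmod (f t) \<le> B"
    using C0_bounded by blast
  then have "bounded (f ` topspace K)"
    by (auto simp: bounded_iff)
  with f show "f \<in> Cb K"
    by (auto simp: C0_def Cb_def)
qed

text \<open>Constants must be cut off outside K, where members of \<open>Cb K\<close> vanish. This
  makes scaling in \<open>C0 K\<close> an instance of multiplication by a bounded function.\<close>

lemma const_Cb: "(\<lambda>t. if t \<in> topspace K then c else 0) \<in> Cb K"
proof -
  have "continuous_map K euclidean (\<lambda>t. if t \<in> topspace K then c else 0)"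
    by (rule continuous_map_eq[of _ _ "\<lambda>t. c"]) auto
  moreover have "bounded ((\<lambda>t. if t \<in> topspace K then c else 0) ` topspace K)"
    by (auto simp: bounded_iff)
  ultimately show ?thesis
    by (auto simp: Cb_def)
qed

lemma C0_mult_Cb:
  assumes "f \<in> C0 K" "g \<in> Cb K"
  shows "(\<lambda>t. f t * g t) \<in> C0 K"
proof -
  obtain B where B: "B > 0" "\<And>t. cmod (g t) \<le> B"
    using Cb_bounded[OF assms(2)] by blast
  have "\<exists>C. compactin K C \<and> (\<forall>t\<in>topspace K - C. cmod (f t * g t) < \<epsilon>)" if "\<epsilon> > 0" for \<epsilon>
  proof -
    have "\<epsilon> / B > 0"
      using that B by simp
    then obtain C where C: "compactin K C" "\<forall>t\<in>topspace K - C. cmod (f t) < \<epsilon> / B"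
      using assms(1) unfolding C0_def by blast
    have "cmod (f t * g t) < \<epsilon>" if "t \<in> topspace K - C" for t
    proof -
      have "cmod (f t * g t) \<le> cmod (f t) * B"
        using B by (simp add: norm_mult mult_left_mono)
      also have "\<dots> < \<epsilon>"
        using C that B by (simp add: pos_less_divide_eq)
      finally show ?thesis .
    qed
    with C show ?thesis by blast
  qed
  then show ?thesis
    using assms by (auto simp: C0_def Cb_def intro!: continuous_intros)
qed

lemma C0_cnj:
  assumes "f \<in> C0 K"
  shows "(\<lambda>t. cnj (f t)) \<in> C0 K"
  using assms by (auto simp: C0_def intro!: continuous_intros)

lemma Cb_cnj:
  assumes "f \<in> Cb K"
  shows "(\<lambda>t. cnj (f t)) \<in> Cb K"
  using assms by (auto simp: Cb_def bounded_iff intro!: continuous_intros)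

lemma C0_scale:
  assumes "f \<in> C0 K"
  shows "(\<lambda>t. c * f t) \<in> C0 K"
proof -
  have "(\<lambda>t. f t * (if t \<in> topspace K then c else 0)) \<in> C0 K"
    by (rule C0_mult_Cb[OF assms const_Cb])
  also have "(\<lambda>t. f t * (if t \<in> topspace K then c else 0)) = (\<lambda>t. c * f t)"
    using assms by (auto simp: C0_def)
  finally show ?thesis .
qed

lemma C0_add:
  assumes "f \<in> C0 K" "g \<in> C0 K"
  shows "(\<lambda>t. f t + g t) \<in> C0 K"
proof -
  have "\<exists>C. compactin K C \<and> (\<forall>t\<in>topspace K - C. cmod (f t + g t) < \<epsilon>)" if "\<epsilon> > 0" for \<epsilon>
  proof -
    have "\<epsilon> / 2 > 0"
      using that by simp
    then obtain C D where C: "compactin K C" "\<forall>t\<in>topspace K - C. cmod (f t) < \<epsilon> / 2"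
      and D: "compactin K D" "\<forall>t\<in>topspace K - D. cmod (g t) < \<epsilon> / 2"
      using assms unfolding C0_def by blast
    have "compactin K (C \<union> D)"
      using C D by (simp add: compactin_Un)
    moreover have "cmod (f t + g t) < \<epsilon>" if "t \<in> topspace K - (C \<union> D)" for t
      using that C D by (intro norm_triangle_lt) force
    ultimately show ?thesis by blast
  qed
  then show ?thesis
    using assms by (auto simp: C0_def intro!: continuous_intros)
qed

lemma C0_diff:
  assumes "f \<in> C0 K" "g \<in> C0 K"
  shows "(\<lambda>t. f t - g t) \<in> C0 K"
  using C0_add[OF assms(1) C0_scale[OF assms(2), of "-1"]] by simp

lemma C0_zero: "(\<lambda>t. 0) \<in> C0 K"
  by (auto simp: C0_def intro!: exI[of _ "{}"])

lemma C0_sum: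
  assumes "\<And>i. i \<in> I \<Longrightarrow> f i \<in> C0 K"
  shows "(\<lambda>t. \<Sum>i\<in>I. f i t) \<in> C0 K"
  using assms
proof (induction I rule: infinite_finite_induct)
  case (insert i I)
  then show ?case
    using C0_add[of "f i" K "\<lambda>t. \<Sum>i\<in>I. f i t"] by simp
qed (simp_all add: C0_zero)

lemma ip_C0_Cb:
  assumes "f \<in> C0 K" "g \<in> Cb K"
  shows "ip f g \<in> C0 K"
  unfolding ip_def by (rule C0_mult_Cb[OF C0_cnj[OF assms(1)] assms(2)])

lemma ip_Cb_C0:
  assumes "f \<in> Cb K" "g \<in> C0 K"
  shows "ip f g \<in> C0 K"
  using C0_mult_Cb[OF assms(2) Cb_cnj[OF assms(1)]] by (simp add: ip_def mult.commute)

lemma C0_cmod_le_supnorm: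
  assumes "f \<in> C0 K" "t \<in> topspace K"
  shows "cmod (f t) \<le> supnorm K f"
proof -
  obtain B where "\<And>t. cmod (f t) \<le> B"
    using C0_bounded[OF assms(1)] by blast
  then have "bdd_above ((\<lambda>t. cmod (f t)) ` topspace K)"
    by (auto intro!: bdd_aboveI2)
  then show ?thesis
    unfolding supnorm_def using assms(2) by (rule cSUP_upper2) auto
qed

text \<open>K is taken nonempty because a real supremum over the empty set has no useful
  value.\<close>

lemma supnorm_le:
  assumes "topspace K \<noteq> {}" "\<And>t. t \<in> topspace K \<Longrightarrow> cmod (f t) \<le> B"
  shows "supnorm K f \<le> B"
  unfolding supnorm_def using assms by (intro cSUP_least)

lemma C0_unit_ball_cmod_le:
  assumes "f \<in> C0_unit_ball K"
  shows "cmod (f t) \<le> 1"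
proof (cases "t \<in> topspace K")
  case True
  then show ?thesis
    using assms C0_cmod_le_supnorm[of f K t] by (auto simp: C0_unit_ball_def)
next
  case False
  then show ?thesis
    using assms by (auto simp: C0_unit_ball_def C0_def)
qed

section \<open>States and admissible systems\<close>

lemma C0_state_add:
  assumes "C0_state K \<phi>" "f \<in> C0 K" "g \<in> C0 K"
  shows "\<phi> (\<lambda>t. f t + g t) = \<phi> f + \<phi> g"
  using assms(1)[unfolded C0_state_def, THEN conjunct1, rule_format, OF assms(2,3)] .

lemma C0_state_scale:
  assumes "C0_state K \<phi>" "f \<in> C0 K"
  shows "\<phi> (\<lambda>t. c * f t) = c * \<phi> f"
  using assms(1)[unfolded C0_state_def, THEN conjunct2, THEN conjunct1, rule_format, OF assms(2)] .

lemma C0_state_sum: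
  assumes \<phi>: "C0_state K \<phi>" and f: "\<And>i. i \<in> I \<Longrightarrow> f i \<in> C0 K"
  shows "\<phi> (\<lambda>t. \<Sum>i\<in>I. c i * f i t) = (\<Sum>i\<in>I. c i * \<phi> (f i))"
proof -
  have z: "\<phi> (\<lambda>t. 0) = 0"
    using C0_state_scale[OF \<phi> C0_zero, of 0] by simp
  show ?thesis
    using f
  proof (induction I rule: infinite_finite_induct)
    case (insert i I)
    have "\<phi> (\<lambda>t. c i * f i t + (\<Sum>i\<in>I. c i * f i t)) =
        \<phi> (\<lambda>t. c i * f i t) + \<phi> (\<lambda>t. \<Sum>i\<in>I. c i * f i t)"
      using insert.prems by (intro C0_state_add[OF \<phi>] C0_scale C0_sum) auto
    moreover have "\<phi> (\<lambda>t. c i * f i t) = c i * \<phi> (f i)"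
      using insert.prems by (intro C0_state_scale[OF \<phi>]) auto
    ultimately show ?case
      using insert by simp
  qed (simp_all add: z)
qed

lemma C0_state_diff:
  assumes \<phi>: "C0_state K \<phi>" and "f \<in> C0 K" "g \<in> C0 K"
  shows "\<phi> (\<lambda>t. f t - g t) = \<phi> f - \<phi> g"
proof -
  have "\<phi> (\<lambda>t. f t + (- 1) * g t) = \<phi> f + \<phi> (\<lambda>t. (- 1) * g t)"
    by (intro C0_state_add[OF \<phi>] C0_scale assms)
  also have "\<phi> (\<lambda>t. (- 1) * g t) = (- 1) * \<phi> g"
    by (intro C0_state_scale[OF \<phi>] assms)
  finally show ?thesis by simp
qed

text \<open>A state has norm 1: dividing by B puts f into the unit ball, where the supremum clause
  of \<open>C0_state\<close> bounds the value by 1.\<close>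

lemma C0_state_bound:
  assumes \<phi>: "C0_state K \<phi>" and f: "f \<in> C0 K" and ne: "topspace K \<noteq> {}"
    and B: "B > 0" "\<And>t. t \<in> topspace K \<Longrightarrow> cmod (f t) \<le> B"
  shows "cmod (\<phi> f) \<le> B"
proof -
  define g where "g = (\<lambda>t. complex_of_real (1 / B) * f t)"
  have "supnorm K g \<le> 1"
    using B by (intro supnorm_le ne) (simp add: g_def norm_mult norm_divide)
  then have "g \<in> C0_unit_ball K"
    using C0_scale[OF f, of "complex_of_real (1 / B)"] unfolding C0_unit_ball_def g_def by blast
  then have "cmod (\<phi> g) \<le> 1"
    using \<phi> cSUP_upper[of g "C0_unit_ball K" "\<lambda>f. cmod (\<phi> f)"] by (simp add: C0_state_def)
  moreover have "\<phi> g = complex_of_real (1 / B) * \<phi> f"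
    unfolding g_def by (rule C0_state_scale[OF \<phi> f])
  ultimately show ?thesis
    using B by (simp add: norm_mult norm_divide)
qed

text \<open>Bessel's inequality with the norm in place of Cauchy--Schwarz for the state: testing the
  functional on \<open>\<Sum> cnj (c i) * ip z (X i)\<close>, where \<open>c i\<close> is its value at \<open>ip z (X i)\<close>,
  yields the sum of the \<open>\<bar>c i\<bar>\<^sup>2\<close>.\<close>

lemma C0_state_Bessel:
  assumes \<phi>: "C0_state K \<phi>" and z: "z \<in> C0 K" and ne: "topspace K \<noteq> {}"
    and X: "\<And>i. i \<in> I \<Longrightarrow> X i \<in> Cb K"
    and A: "A > 0" "\<And>t. t \<in> topspace K \<Longrightarrow> cmod (z t) \<le> A"
    and b: "b > 0" "\<And>t. t \<in> topspace K \<Longrightarrow> (\<Sum>i\<in>I. (cmod (X i t))\<^sup>2) \<le> b"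
  shows "(\<Sum>i\<in>I. (cmod (\<phi> (ip z (X i))))\<^sup>2) \<le> A\<^sup>2 * b"
proof -
  define c where "c = (\<lambda>i. \<phi> (ip z (X i)))"
  define s where "s = (\<Sum>i\<in>I. (cmod (c i))\<^sup>2)"
  have s0: "s \<ge> 0"
    by (simp add: s_def sum_nonneg)
  have "s \<le> A\<^sup>2 * b"
  proof (cases "s = 0")
    case True
    then show ?thesis using A b by simp
  next
    case False
    then have s: "s > 0" using s0 by simp
    define h where "h = (\<lambda>t. \<Sum>i\<in>I. cnj (c i) * ip z (X i) t)"
    have h0: "h \<in> C0 K"
      unfolding h_def by (intro C0_sum C0_scale ip_C0_Cb z X)
    have hb: "cmod (h t) \<le> A * (sqrt s * sqrt b)" if t: "t \<in> topspace K" for t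
    proof -
      \<comment> \<open>The factor from z does not depend on i; once it is pulled out,
        Cauchy-Schwarz over I applies pointwise to the remaining sum.\<close>
      have "h t = cnj (z t) * (\<Sum>i\<in>I. cnj (c i) * X i t)"
        by (simp add: h_def ip_def sum_distrib_left mult_ac)
      then have "cmod (h t) = cmod (z t) * cmod (\<Sum>i\<in>I. cnj (c i) * X i t)"
        by (simp add: norm_mult)
      also have "\<dots> \<le> A * (sqrt s * sqrt b)"
      proof (intro mult_mono A(2)[OF t])
        have "cmod (\<Sum>i\<in>I. cnj (c i) * X i t) \<le> (\<Sum>i\<in>I. cmod (c i) * cmod (X i t))"
          by (rule order_trans[OF norm_sum]) (simp add: norm_mult)
        also have "\<dots> \<le> L2_set (\<lambda>i. cmod (c i)) I * L2_set (\<lambda>i. cmod (X i t)) I"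
          using L2_set_mult_ineq[of "\<lambda>i. cmod (c i)" "\<lambda>i. cmod (X i t)" I] by simp
        also have "\<dots> \<le> sqrt s * sqrt b"
          unfolding L2_set_def s_def using b(2)[OF t]
          by (intro mult_mono) (auto intro: sum_nonneg)
        finally show "cmod (\<Sum>i\<in>I. cnj (c i) * X i t) \<le> sqrt s * sqrt b" .
      qed (use A in auto)
      finally show ?thesis .
    qed
    have "\<phi> h = (\<Sum>i\<in>I. cnj (c i) * c i)"
      unfolding h_def c_def using ip_C0_Cb[OF z X]
      by (rule C0_state_sum[OF \<phi>, where f = "\<lambda>i. ip z (X i)"])
    also have "\<dots> = complex_of_real s"
      unfolding s_def of_real_sum
      by (intro sum.cong refl) (metis complex_norm_square mult.commute of_real_power)
    finally have "s = cmod (\<phi> h)"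
      using s by simp
    also have "\<dots> \<le> A * (sqrt s * sqrt b)"
      using s b A by (intro C0_state_bound[OF \<phi> h0 ne _ hb]) auto
    finally have "sqrt s * sqrt s \<le> sqrt s * (A * sqrt b)"
      using s by (simp add: mult_ac)
    then have "sqrt s \<le> A * sqrt b"
      by (rule mult_left_le_imp_le) (use s in simp)
    then have "(sqrt s)\<^sup>2 \<le> (A * sqrt b)\<^sup>2"
      using s by (intro power_mono) auto
    then show ?thesis
      using s b by (simp add: power_mult_distrib)
  qed
  then show ?thesis
    by (simp add: s_def c_def)
qed

text \<open>The i-th term of the series in \<open>C0_admissible\<close> is |e|^2 |X i|^2, and norm
  convergence makes the partial sums uniformly Cauchy. Wherever e = 1, this controls the tails of
  the sum of |X i|^2.\<close>

lemma C0_admissible_tail: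
  assumes X: "C0_admissible K X" and e: "e \<in> C0 K" and "\<epsilon> > 0"
  obtains N where "\<And>n t. t \<in> topspace K \<Longrightarrow> (\<Sum>i=N..<n. (cmod (e t))\<^sup>2 * (cmod (X i t))\<^sup>2) < \<epsilon>"
proof -
  define S where "S = (\<lambda>n t. \<Sum>i<n. ip e (X i) t * ip (X i) e t)"
  obtain s where s: "s \<in> C0 K" "(\<lambda>n. supnorm K (\<lambda>t. S n t - s t)) \<longlonglongrightarrow> 0"
    using X e unfolding C0_admissible_def S_def by blast
  have XCb: "X i \<in> Cb K" for i
    using X by (simp add: C0_admissible_def)
  have "(\<lambda>t. ip e (X i) t * ip (X i) e t) \<in> C0 K" for i
    using C0_mult_Cb[OF ip_C0_Cb[OF e XCb]] ip_Cb_C0[OF XCb e] C0_subset_Cb by blast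
  then have SC0: "(\<lambda>t. S n t - s t) \<in> C0 K" for n
    unfolding S_def by (intro C0_diff C0_sum s)
  have "\<forall>\<^sub>F n in sequentially. supnorm K (\<lambda>t. S n t - s t) < \<epsilon> / 2"
    using order_tendstoD(2)[OF s(2), of "\<epsilon> / 2"] \<open>\<epsilon> > 0\<close> by simp
  then obtain N where "\<And>n. n \<ge> N \<Longrightarrow> supnorm K (\<lambda>t. S n t - s t) < \<epsilon> / 2"
    by (auto simp: eventually_sequentially)
  then have N: "cmod (S n t - s t) < \<epsilon> / 2" if "n \<ge> N" "t \<in> topspace K" for n t
    using C0_cmod_le_supnorm[OF SC0, of t n] that by fastforce
  have S: "S n t = complex_of_real (\<Sum>i<n. (cmod (e t))\<^sup>2 * (cmod (X i t))\<^sup>2)" for n t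
    unfolding S_def of_real_sum
  proof (intro sum.cong refl)
    fix i
    have "ip e (X i) t * ip (X i) e t = (e t * cnj (e t)) * (X i t * cnj (X i t))"
      by (simp add: ip_def mult_ac)
    also have "\<dots> = complex_of_real ((cmod (e t))\<^sup>2 * (cmod (X i t))\<^sup>2)"
      by (simp add: complex_norm_square[symmetric] flip: of_real_power)
    finally show "ip e (X i) t * ip (X i) e t = complex_of_real ((cmod (e t))\<^sup>2 * (cmod (X i t))\<^sup>2)" .
  qed
  have "(\<Sum>i=N..<n. (cmod (e t))\<^sup>2 * (cmod (X i t))\<^sup>2) < \<epsilon>" if t: "t \<in> topspace K" for n t
  proof (cases "N \<le> n")
    case True
    have "S n t - S N t = complex_of_real (\<Sum>i=N..<n. (cmod (e t))\<^sup>2 * (cmod (X i t))\<^sup>2)"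
      unfolding S of_real_diff[symmetric]
      using sum_diff_nat_ivl[of 0 N n "\<lambda>i. (cmod (e t))\<^sup>2 * (cmod (X i t))\<^sup>2"] True
      by (simp add: atLeast0LessThan)
    then have "Re (S n t - S N t) = (\<Sum>i=N..<n. (cmod (e t))\<^sup>2 * (cmod (X i t))\<^sup>2)"
      by (simp only: Re_complex_of_real)
    then have "(\<Sum>i=N..<n. (cmod (e t))\<^sup>2 * (cmod (X i t))\<^sup>2) = Re ((S n t - s t) - (S N t - s t))"
      by simp
    also have "\<dots> \<le> cmod (S n t - s t) + cmod (S N t - s t)"
      by (rule order_trans[OF complex_Re_le_cmod norm_triangle_ineq4])
    also have "\<dots> < \<epsilon>"
      using N[OF True t] N[OF order_refl t] by simp
    finally show ?thesis .
  qed (use \<open>\<epsilon> > 0\<close> in simp)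
  then show ?thesis
    using that by blast
qed

section \<open>Reduction of total boundedness to uniform tails\<close>

text \<open>Each y is labelled by choosing, for every j in J, a point near \<open>g j y\<close> from
  a finite \<eta>/2-net of the disc. Only finitely many labels occur, and equal labels put the
  values within \<eta>, so one representative in Y per label suffices.\<close>

lemma finite_net_of_bounded_functions:
  fixes g :: "'j \<Rightarrow> 'y \<Rightarrow> complex"
  assumes J: "finite J" and bd: "\<And>j y. j \<in> J \<Longrightarrow> y \<in> Y \<Longrightarrow> cmod (g j y) \<le> B" and "\<eta> > 0"
  obtains F where "finite F" "F \<subseteq> Y" "\<forall>y\<in>Y. \<exists>f\<in>F. \<forall>j\<in>J. cmod (g j f - g j y) < \<eta>"
proof -
  have "\<exists>D. finite D \<and> D \<subseteq> cball 0 B \<and> cball 0 B \<subseteq> (\<Union>x\<in>D. ball x (\<eta> / 2) :: complex set)"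
    using seq_compact_imp_totally_bounded[of "cball (0 :: complex) B"] \<open>\<eta> > 0\<close>
    by (simp add: compact_imp_seq_compact)
  then obtain D where D: "finite D" "cball 0 B \<subseteq> (\<Union>x\<in>D. ball x (\<eta> / 2) :: complex set)"
    by blast
  define near where "near = (\<lambda>j y. SOME x. x \<in> D \<and> dist x (g j y) < \<eta> / 2)"
  have near: "near j y \<in> D \<and> dist (near j y) (g j y) < \<eta> / 2" if "j \<in> J" "y \<in> Y" for j y
  proof -
    have "g j y \<in> cball 0 B"
      using bd that by simp
    then have "\<exists>x\<in>D. g j y \<in> ball x (\<eta> / 2)"
      using D(2) by blast
    then have "\<exists>x. x \<in> D \<and> dist x (g j y) < \<eta> / 2"
      by (simp add: Bex_def)
    then show ?thesis
      unfolding near_def by (rule someI_ex)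
  qed
  \<comment> \<open>Restricting to J places the labels in a finite product.\<close>
  define label where "label = (\<lambda>y. \<lambda>j\<in>J. near j y)"
  have "label ` Y \<subseteq> PiE J (\<lambda>_. D)"
    using near by (auto simp: label_def)
  then have fin: "finite (label ` Y)"
    using finite_PiE[OF J] D(1) by (meson finite_subset)
  have "\<forall>y\<in>Y. \<exists>f\<in>inv_into Y label ` label ` Y. \<forall>j\<in>J. cmod (g j f - g j y) < \<eta>"
  proof
    fix y assume y: "y \<in> Y"
    define f where "f = inv_into Y label (label y)"
    have f: "f \<in> Y" "label f = label y"
      using y by (auto simp: f_def inv_into_into f_inv_into_f)
    have "cmod (g j f - g j y) < \<eta>" if j: "j \<in> J" for j
    proof -
      have "near j f = near j y"
        using fun_cong[OF f(2), of j] j by (simp add: label_def)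
      then show ?thesis
        using near[OF j f(1)] near[OF j y] dist_triangle_half_r[of "near j y" "g j f" \<eta> "g j y"]
        by (simp add: dist_norm)
    qed
    then show "\<exists>f\<in>inv_into Y label ` label ` Y. \<forall>j\<in>J. cmod (g j f - g j y) < \<eta>"
      using y unfolding f_def by blast
  qed
  moreover have "finite (inv_into Y label ` label ` Y)"
    using fin by simp
  moreover have "inv_into Y label ` label ` Y \<subseteq> Y"
    by (auto intro: inv_into_into)
  ultimately show ?thesis
    using that by blast
qed

text \<open>In \<^const>\<open>d_pm\<close> the functional \<open>\<Phi> k\<close> is tested only against \<open>X i\<close> with \<open>i \<ge> k\<close>, so once the tails of
  \<open>\<Sum> \<bar>X i\<bar>\<^sup>2\<close> are uniformly small only finitely many pairs \<open>(k, i)\<close> matter.\<close>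

lemma unit_ball_totally_bounded_if_uniform_tails:
  assumes ne: "topspace K \<noteq> {}"
    and tails: "\<And>X \<delta>. C0_admissible K X \<Longrightarrow> \<delta> > 0 \<Longrightarrow>
      \<exists>N. \<forall>n. \<forall>t\<in>topspace K. (\<Sum>i=N..<n. (cmod (X i t))\<^sup>2) \<le> \<delta>"
  shows "Cb_C0_totally_bounded K (C0_unit_ball K)"
  unfolding Cb_C0_totally_bounded_def
proof (intro allI impI)
  fix X and \<Phi> :: "nat \<Rightarrow> _" and \<epsilon> :: real
  assume X: "C0_admissible K X" and \<Phi>: "\<forall>k. C0_state K (\<Phi> k)" and \<epsilon>: "\<epsilon> > 0"
  let ?Y = "C0_unit_ball K"
  have XCb: "X i \<in> Cb K" for i
    using X by (simp add: C0_admissible_def)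
  have YC0: "y \<in> C0 K" if "y \<in> ?Y" for y
    using that by (simp add: C0_unit_ball_def)
  \<comment> \<open>Differences of elements of the unit ball are bounded by 2, so Bessel's
    inequality will give 2^2 * (\<epsilon>/4)^2 = \<epsilon>^2/4.\<close>
  obtain N where N: "\<And>n t. t \<in> topspace K \<Longrightarrow> (\<Sum>i=N..<n. (cmod (X i t))\<^sup>2) \<le> (\<epsilon> / 4)\<^sup>2"
    using tails[OF X, of "(\<epsilon> / 4)\<^sup>2"] \<epsilon> by auto
  \<comment> \<open>At most N terms of size \<eta>^2 will be added, and N \<le> (N + 1)^2, so they
    contribute at most (\<epsilon>/2)^2. Using N + 1 avoids division by 0 when N = 0.\<close>
  define \<eta> where "\<eta> = \<epsilon> / (2 * (N + 1))"
  have \<eta>: "\<eta> > 0"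
    using \<epsilon> by (simp add: \<eta>_def)
  define J where "J = {..<N} \<times> {..<N}"
  define g where "g = (\<lambda>(k, i) y. \<Phi> k (ip y (X i)))"
  have "\<exists>B. \<forall>y\<in>?Y. cmod (g j y) \<le> B" for j :: "nat \<times> nat"
  proof -
    obtain k i where j: "j = (k, i)" by fastforce
    obtain B where B: "B > 0" "\<And>t. cmod (X i t) \<le> B"
      using Cb_bounded[OF XCb] by blast
    have "cmod (g j y) \<le> B" if y: "y \<in> ?Y" for y
      unfolding j g_def prod.case
    proof (rule C0_state_bound[OF _ ip_C0_Cb ne])
      show "cmod (ip y (X i) t) \<le> B" for t
        using mult_mono[OF C0_unit_ball_cmod_le[OF y, of t] B(2)[of t]]
        by (simp add: ip_def norm_mult)
    qed (use \<Phi> XCb YC0 y B in auto)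
    then show ?thesis by blast
  qed
  then obtain B where B: "\<And>j y. y \<in> ?Y \<Longrightarrow> cmod (g j y) \<le> B j"
    by metis
  have fJ: "finite J" by (simp add: J_def)
  \<comment> \<open>Inserting 0 keeps the maximum defined when J is empty, that is, when N =
    0.\<close>
  have gB: "cmod (g j y) \<le> Max (insert 0 (B ` J))" if "j \<in> J" "y \<in> ?Y" for j y
    using fJ that(1) by (intro order_trans[OF B[OF that(2)] Max_ge]) auto
  obtain F where F: "finite F" "F \<subseteq> ?Y"
    "\<forall>y\<in>?Y. \<exists>f\<in>F. \<forall>j\<in>J. cmod (g j f - g j y) < \<eta>"
    by (rule finite_net_of_bounded_functions[where Y = ?Y and g = g, OF fJ _ \<eta>],
        erule (1) gB, rule that)
  have "\<exists>f\<in>F. d_pm X \<Phi> f y < \<epsilon>" if y: "y \<in> ?Y" for y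
  proof -
    obtain f where f: "f \<in> F" "\<And>k i. k < N \<Longrightarrow> i < N \<Longrightarrow> cmod (g (k, i) f - g (k, i) y) < \<eta>"
      using bspec[OF F(3) y] unfolding J_def by blast
    have fY: "f \<in> ?Y" using f F by blast
    define z where "z = (\<lambda>t. f t - y t)"
    have zC0: "z \<in> C0 K"
      unfolding z_def by (intro C0_diff YC0 fY y)
    have z2: "cmod (z t) \<le> 2" for t
      using norm_triangle_ineq4[of "f t" "y t"] C0_unit_ball_cmod_le[OF fY, of t]
        C0_unit_ball_cmod_le[OF y, of t] by (simp add: z_def)
    define a where "a = (\<lambda>k i. (cmod (\<Phi> k (ip z (X i))))\<^sup>2)"
    have a0: "a k i \<ge> 0" for k i by (simp add: a_def)
    have tail: "(\<Sum>i=N..<n. a k i) \<le> \<epsilon>\<^sup>2 / 4" for k n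
    proof -
      have "(\<Sum>i=N..<n. a k i) \<le> 2\<^sup>2 * (\<epsilon> / 4)\<^sup>2"
        unfolding a_def using \<Phi> \<epsilon> N z2 by (intro C0_state_Bessel[OF _ zC0 ne XCb]) auto
      then show ?thesis by (simp add: power_divide)
    qed
    have head: "a k i \<le> \<eta>\<^sup>2" if "k < N" "i < N" for k i
    proof -
      have "ip z (X i) = (\<lambda>t. ip f (X i) t - ip y (X i) t)"
        by (auto simp: ip_def z_def algebra_simps)
      then have "\<Phi> k (ip z (X i)) = g (k, i) f - g (k, i) y"
        using C0_state_diff[OF \<Phi>[rule_format] ip_C0_Cb[OF YC0[OF fY] XCb] ip_C0_Cb[OF YC0[OF y] XCb]]
        by (simp add: g_def)
      then show ?thesis
        using f(2)[OF that] by (simp add: a_def power_mono)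
    qed
    have below: "(\<Sum>i=k..<N. a k i) \<le> \<epsilon>\<^sup>2 / 4" for k
    proof (cases "k < N")
      case True
      have "(\<Sum>i=k..<N. a k i) \<le> (\<Sum>i=k..<N. \<eta>\<^sup>2)"
        using head True by (intro sum_mono) auto
      also have "\<dots> \<le> (real N + 1)\<^sup>2 * \<eta>\<^sup>2"
      proof -
        have "real (N - k) \<le> (real N + 1)\<^sup>2"
          using True by (auto simp: power2_eq_square of_nat_diff algebra_simps)
        then show ?thesis
          by (simp add: mult_right_mono)
      qed
      also have "\<dots> = ((real N + 1) * \<eta>)\<^sup>2"
        by (simp add: power_mult_distrib)
      also have "(real N + 1) * \<eta> = \<epsilon> / 2"
        by (simp add: \<eta>_def field_simps)
      finally show ?thesis
        by (simp add: power_divide)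
    next
      case False
      then show ?thesis by simp
    qed
    have part: "(\<Sum>i<m. a k (k + i)) \<le> \<epsilon>\<^sup>2 / 2" for k m
    proof -
      have "(\<Sum>i<m. a k (k + i)) = (\<Sum>i=k..<k + m. a k i)"
        using sum.shift_bounds_nat_ivl[of "a k" 0 k m]
        by (simp add: atLeast0LessThan add.commute)
      \<comment> \<open>This union contains the index range whatever the order of k, N and k + m;
        the added terms are nonnegative.\<close>
      also have "\<dots> \<le> (\<Sum>i\<in>{k..<N} \<union> {N..<k + m}. a k i)"
        using a0 by (intro sum_mono2) auto
      also have "\<dots> = (\<Sum>i=k..<N. a k i) + (\<Sum>i=N..<k + m. a k i)"
        by (intro sum.union_disjoint) auto
      also have "\<dots> \<le> \<epsilon>\<^sup>2 / 2"
        using below[of k] tail[of k "k + m"] by simp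
      finally show ?thesis .
    qed
    \<comment> \<open>The bounded partial sums give summability too. The value \<epsilon>^2/2 leaves
      room for a strict inequality after the supremum over k.\<close>
    have "(\<Sum>i. a k (k + i)) \<le> \<epsilon>\<^sup>2 / 2" for k
      using part a0 by (intro suminf_le_const summableI_nonneg_bounded[where x = "\<epsilon>\<^sup>2 / 2"]) auto
    then have "(SUP k. \<Sum>i. a k (k + i)) \<le> \<epsilon>\<^sup>2 / 2"
      by (intro cSUP_least) auto
    also have "\<dots> < \<epsilon>\<^sup>2"
      using \<epsilon> by simp
    finally have "sqrt (SUP k. \<Sum>i. a k (k + i)) < sqrt (\<epsilon>\<^sup>2)"
      by (simp only: real_sqrt_less_iff)
    then have "d_pm X \<Phi> f y < \<epsilon>"
      using \<epsilon> by (simp add: d_pm_def a_def z_def)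
    with f(1) show ?thesis by blast
  qed
  then have "?Y \<subseteq> (\<Union>f\<in>F. {y \<in> ?Y. d_pm X \<Phi> f y < \<epsilon>})"
    by blast
  with F show "\<exists>F. finite F \<and> F \<subseteq> ?Y \<and> ?Y \<subseteq> (\<Union>f\<in>F. {y \<in> ?Y. d_pm X \<Phi> f y < \<epsilon>})"
    by blast
qed

section \<open>The corner space\<close>

abbreviation full_product :: "'p topology \<Rightarrow> ('p option \<times> enat) topology" where
  "full_product P \<equiv> prod_topology (Alexandroff_compactification P) euclidean"

lemma compact_space_full_product: "compact_space (full_product P)"
proof -
  have "compact (UNIV :: enat set)"
    by (rule compact_UNIV)
  then have "compact_space (euclidean :: enat topology)"
    by (simp add: compact_space_def)
  then show ?thesis
    by (simp add: compact_space_prod_topology)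
qed

lemma topspace_corner_space:
  "topspace (corner_space P) = insert None (Some ` topspace P) \<times> UNIV - {(None, \<infinity>)}"
  by (auto simp: corner_space_def Let_def)

text \<open>The set where |f| \<ge> \<epsilon> is closed in the compact product and misses the
  corner, where f is 0, so it is a compact subset of K.\<close>

lemma C0_corner_spaceI:
  assumes cont: "continuous_map (full_product P) euclidean f"
    and "f (None, \<infinity>) = 0" "\<And>q n. q \<notin> topspace (Alexandroff_compactification P) \<Longrightarrow> f (q, n) = 0"
  shows "f \<in> C0 (corner_space P)"
proof -
  let ?Q = "full_product P"
  have "\<exists>C. compactin (corner_space P) C \<and> (\<forall>t\<in>topspace (corner_space P) - C. cmod (f t) < \<epsilon>)"
    if "\<epsilon> > 0" for \<epsilon>
  proof (intro exI conjI)
    let ?C = "{t \<in> topspace ?Q. cmod (f t) \<in> {\<epsilon>..}}"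
    have "closedin ?Q ?C"
      by (rule closedin_continuous_map_preimage[OF continuous_map_norm[OF cont]]) simp
    then have "compactin ?Q ?C"
      by (rule closedin_compact_space[OF compact_space_full_product])
    then show "compactin (corner_space P) ?C"
      using assms(2) that by (auto simp: corner_space_def Let_def compactin_subtopology)
    show "\<forall>t\<in>topspace (corner_space P) - ?C. cmod (f t) < \<epsilon>"
      by (auto simp: topspace_corner_space)
  qed
  moreover have "continuous_map (corner_space P) euclidean f"
    unfolding corner_space_def Let_def by (rule continuous_map_from_subtopology[OF cont])
  moreover have "f t = 0" if "t \<notin> topspace (corner_space P)" for t
    using that assms(2,3) by (cases t) (auto simp: topspace_corner_space)
  ultimately show ?thesis
    by (auto simp: C0_def)
qed

text \<open>Only finite levels are taken: level \<infinity> contains the removed corner, where f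
  need not extend continuously.\<close>

lemma continuous_map_corner_space_slice:
  assumes "f \<in> Cb (corner_space P)"
  shows "continuous_map (Alexandroff_compactification P) euclidean (\<lambda>q. f (q, enat n))"
proof -
  have "continuous_map (Alexandroff_compactification P) (corner_space P) (\<lambda>q. (q, enat n))"
    unfolding corner_space_def Let_def
    by (auto simp: continuous_map_in_subtopology intro!: continuous_map_pairedI)
  then show ?thesis
    using assms continuous_map_compose[of _ _ "\<lambda>q. (q, enat n)" euclidean f]
    by (auto simp: Cb_def o_def)
qed

section \<open>Uniform tails from the class of P\<close>

lemma sigma_compactin_countable:
  assumes "countable S" "S \<subseteq> topspace P"
  shows "sigma_compactin P S"
  unfolding sigma_compactin_def
  using assms by (intro exI[of _ "(\<lambda>x. {x}) ` S"]) auto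

lemma sigma_compactin_UN:
  assumes "countable I" "\<And>i. i \<in> I \<Longrightarrow> compactin P (C i)"
  shows "sigma_compactin P (\<Union>i\<in>I. C i)"
  unfolding sigma_compactin_def
  using assms by (intro exI[of _ "C ` I"]) auto

text \<open>The values of a continuous function near the point at infinity are those at infinity, up to a
  compact set for each tolerance.\<close>

lemma class_K_IV_agree_at_infinity:
  fixes h :: "'i::countable \<Rightarrow> 'p option \<Rightarrow> complex"
  assumes P: "class_K_IV P"
    and h: "\<And>j. continuous_map (Alexandroff_compactification P) euclidean (h j)"
  obtains p where "p \<in> topspace P" "\<And>j. h j (Some p) = h j None"
proof -
  let ?A = "Alexandroff_compactification P"
  define D where "D = (\<lambda>(j, m). {p \<in> topspace P. inverse (Suc m) \<le> cmod (h j (Some p) - h j None)})"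
  have cD: "compactin P (D (j, m))" for j m
  proof -
    have "continuous_map ?A euclidean (\<lambda>q. cmod (h j q - h j None))"
      by (intro continuous_intros h) simp
    from closedin_continuous_map_preimage[OF this, of "{inverse (Suc m)..}"]
    have "closedin ?A {q \<in> topspace ?A. cmod (h j q - h j None) \<in> {inverse (Suc m)..}}"
      by simp
    \<comment> \<open>The set misses \<open>None\<close>, where the difference is 0; a closed set
      missing \<open>None\<close> comes from a compact subset of P.\<close>
    also have "{q \<in> topspace ?A. cmod (h j q - h j None) \<in> {inverse (Suc m)..}} = Some ` D (j, m)"
      by (auto simp: D_def)
    finally show ?thesis
      by simp
  qed
  have "sigma_compactin P (\<Union>(D ` UNIV))"
    using cD by (intro sigma_compactin_UN) auto
  then have "P interior_of (topspace P - \<Union>(D ` UNIV)) \<noteq> {}"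
    using P by (simp add: class_K_IV_def)
  then obtain p where "p \<in> P interior_of (topspace P - \<Union>(D ` UNIV))"
    by blast
  then have "p \<in> topspace P - \<Union>(D ` UNIV)"
    by (rule subsetD[OF interior_of_subset])
  then have p: "p \<in> topspace P" "\<And>j m. p \<notin> D (j, m)"
    by auto
  have "h j (Some p) = h j None" for j
  proof (rule ccontr)
    assume "h j (Some p) \<noteq> h j None"
    then obtain m where m: "inverse (Suc m) < cmod (h j (Some p) - h j None)"
      using reals_Archimedean[of "cmod (h j (Some p) - h j None)"] by auto
    then show False
      using p(1) p(2)[of j m] by (simp add: D_def)
  qed
  with p(1) show ?thesis
    using that by blast
qed

text \<open>The clause about infinity gives a neighbourhood V of \<open>None\<close> disjoint from
  S. A Urysohn function on the compactification, 0 at \<open>None\<close> and 1 off V, is made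
  constant in the ordinal coordinate; it then vanishes on the whole fibre over \<open>None\<close>,
  including the corner.\<close>

lemma class_K_IV_cutoff:
  assumes P: "class_K_IV P" and S: "countable S" "S \<subseteq> topspace P"
  obtains e where "e \<in> C0 (corner_space P)" "\<And>p n. p \<in> S \<Longrightarrow> e (Some p, n) = 1"
proof -
  let ?A = "Alexandroff_compactification P"
  define V where "V = ?A interior_of (topspace ?A - Some ` S)"
  have "None \<in> V"
    using P sigma_compactin_countable[OF S] by (simp add: class_K_IV_def V_def)
  have V: "openin ?A V" "V \<subseteq> topspace ?A - Some ` S"
    unfolding V_def by (simp_all add: openin_interior_of interior_of_subset)
  have hA: "Hausdorff_space ?A"
    using P by (simp add: class_K_IV_def Hausdorff_space_Alexandroff_compactification)
  then have "normal_space ?A"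
    by (simp add: compact_Hausdorff_or_regular_imp_normal_space)
  moreover have "closedin ?A {None}"
    using hA by (simp add: closedin_Hausdorff_singleton)
  moreover have "closedin ?A (topspace ?A - V)"
    using V(1) by blast
  moreover have "disjnt {None} (topspace ?A - V)"
    using \<open>None \<in> V\<close> by (simp add: disjnt_def)
  ultimately obtain u :: "'a option \<Rightarrow> real" where u: "continuous_map ?A euclideanreal u"
      "u ` {None} \<subseteq> {0}" "u ` (topspace ?A - V) \<subseteq> {1}"
    using Urysohn_lemma_alt by metis
  define e where "e = (\<lambda>(q, n::enat). if q \<in> topspace ?A then complex_of_real (u q) else 0)"
  show ?thesis
  proof
    have "continuous_map (full_product P) euclidean (complex_of_real \<circ> (u \<circ> fst))"
      by (intro continuous_map_compose[OF continuous_map_compose[OF continuous_map_fst u(1)]])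
        (simp add: continuous_on_of_real_id)
    then have "continuous_map (full_product P) euclidean e"
      by (rule continuous_map_eq) (auto simp: e_def)
    then show "e \<in> C0 (corner_space P)"
      using u(2) by (intro C0_corner_spaceI) (auto simp: e_def)
    show "e (Some p, n) = 1" if "p \<in> S" for p n
    proof -
      have "Some p \<in> topspace ?A - V"
        using that V(2) S(2) by auto
      then show ?thesis
        using u(3) by (auto simp: e_def)
    qed
  qed
qed

lemma corner_space_uniform_tails:
  fixes P :: "'p topology"
  assumes P: "class_K_IV P" and X: "C0_admissible (corner_space P) X" and "\<delta> > 0"
  shows "\<exists>N. \<forall>n. \<forall>t\<in>topspace (corner_space P). (\<Sum>i=N..<n. (cmod (X i t))\<^sup>2) \<le> \<delta>"
proof (rule ccontr)
  assume "\<not> ?thesis"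
  then have "\<forall>N. \<exists>n t. t \<in> topspace (corner_space P) \<and> \<not> (\<Sum>i=N..<n. (cmod (X i t))\<^sup>2) \<le> \<delta>"
    by blast
  \<comment> \<open>Bad points are fixed for all N at once, so that the cutoff e can be chosen
    before N.\<close>
  then obtain n t where t: "\<And>N. t N \<in> topspace (corner_space P)"
      "\<And>N. \<not> (\<Sum>i=N..<n N. (cmod (X i (t N)))\<^sup>2) \<le> \<delta>"
    by metis
  have XCb: "X i \<in> Cb (corner_space P)" for i
    using X by (simp add: C0_admissible_def)
  define h where "h = (\<lambda>(i, m) q. X i (q, enat m))"
  have h: "continuous_map (Alexandroff_compactification P) euclidean (h j)" for j
    using continuous_map_corner_space_slice[OF XCb] by (cases j) (simp add: h_def)
  obtain p where p: "p \<in> topspace P" "\<And>j. h j (Some p) = h j None"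
    by (rule class_K_IV_agree_at_infinity[where h = h, OF P h], rule that)
  \<comment> \<open>Points over infinity are moved over p; all others keep their first
    coordinate.\<close>
  define r where "r = (\<lambda>N. case fst (t N) of None \<Rightarrow> p | Some q \<Rightarrow> q)"
  have r: "r N \<in> topspace P" for N
    using t(1)[of N] p(1) by (auto simp: r_def topspace_corner_space split: option.split)
  have Xr: "X i (Some (r N), snd (t N)) = X i (t N)" for i N
  proof (cases "t N")
    case (Pair q m)
    show ?thesis
    proof (cases q)
      case None
      \<comment> \<open>The removal of the corner enters here: over infinity only finite levels
        remain, and there p is indistinguishable from \<open>None\<close>.\<close>
      then obtain m' where "m = enat m'"
        using t(1)[of N] Pair by (cases m) (auto simp: topspace_corner_space)
      then show ?thesis
        using p(2)[of "(i, m')"] Pair None by (simp add: r_def h_def)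
    qed (simp add: r_def Pair)
  qed
  \<comment> \<open>The range of r is countable, so a single e equals 1 at all the moved points and
    bounds the tails along them by one N.\<close>
  obtain e where e: "e \<in> C0 (corner_space P)" "\<And>N m. e (Some (r N), m) = 1"
    using class_K_IV_cutoff[OF P, of "range r"] r by (metis countableI_type countable_image
        image_subset_iff rangeI)
  obtain N where N: "\<And>n t. t \<in> topspace (corner_space P) \<Longrightarrow>
      (\<Sum>i=N..<n. (cmod (e t))\<^sup>2 * (cmod (X i t))\<^sup>2) < \<delta>"
    using C0_admissible_tail[OF X e(1) \<open>\<delta> > 0\<close>] by blast
  have "(Some (r N), snd (t N)) \<in> topspace (corner_space P)"
    using r by (simp add: topspace_corner_space)
  from N[OF this, of "n N"] have "(\<Sum>i=N..<n N. (cmod (X i (t N)))\<^sup>2) < \<delta>"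
    by (simp add: e(2) Xr)
  with t(2)[of N] show False by simp
qed

section \<open>The identity is not compact\<close>

text \<open>\<open>K\<close> is not compact: the points \<open>(p\<^sub>\<infinity>, n)\<close> converge to the removed corner.\<close>

lemma corner_space_leaves_compact:
  fixes P :: "'p topology"
  assumes P: "class_K_IV P" and C: "compactin (corner_space P) C"
  obtains n where "(None, enat n) \<notin> C"
proof -
  \<comment> \<open>Hausdorffness makes C closed in the full product, hence its trace on the fibre
    over \<open>None\<close> is closed.\<close>
  have "Hausdorff_space (euclidean :: enat topology)"
    unfolding Hausdorff_space_def by (simp add: disjnt_def separation_t2)
  then have "Hausdorff_space (full_product P)"
    using P by (simp add: class_K_IV_def Hausdorff_space_Alexandroff_compactification
        Hausdorff_space_prod_topology)
  moreover have C': "compactin (full_product P) C" "(None, \<infinity>) \<notin> C"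
    using C by (auto simp: corner_space_def Let_def compactin_subtopology)
  ultimately have "closedin (full_product P) C"
    by (simp add: compactin_imp_closedin)
  moreover have "continuous_map euclidean (full_product P) (\<lambda>n. (None, n))"
    by (intro continuous_map_pairedI) auto
  ultimately have "closedin euclidean {n :: enat \<in> topspace euclidean. (None, n) \<in> C}"
    using closedin_continuous_map_preimage by fastforce
  then have "open (- {n :: enat. (None, n) \<in> C})"
    by (simp add: open_Compl)
  moreover have "\<infinity> \<in> - {n :: enat. (None, n) \<in> C}"
    using C' by simp
  ultimately obtain m where "{enat m <..} \<subseteq> - {n :: enat. (None, n) \<in> C}"
    unfolding open_enat_iff by blast
  \<comment> \<open>The neighbourhood of \<infinity> is the open ray above m, so the first level
    certain to lie in it is m + 1.\<close>
  moreover have "enat (Suc m) \<in> {enat m <..}"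
    by simp
  ultimately have "(None, enat (Suc m)) \<notin> C"
    by blast
  then show ?thesis
    using that by blast
qed

text \<open>By commutativity x * \<langle>y, z\<rangle> = (x * cnj y) * z, and x * cnj y again
  vanishes at infinity.\<close>

lemma elem_op_span_multiplication:
  assumes "F \<in> elem_op_span K"
  obtains g where "g \<in> C0 K" "\<And>z t. F z t = g t * z t"
proof -
  obtain n :: nat and c x y where xy: "\<And>i. i < n \<Longrightarrow> x i \<in> C0 K \<and> y i \<in> C0 K"
    and F: "F = (\<lambda>z t. \<Sum>i<n. c i * elem_op (x i) (y i) z t)"
    using assms unfolding elem_op_span_def by blast
  define g where "g = (\<lambda>t. \<Sum>i<n. c i * (x i t * cnj (y i t)))"
  show ?thesis
  proof
    show "g \<in> C0 K"
      unfolding g_def using xy C0_subset_Cb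
      by (intro C0_sum C0_scale C0_mult_Cb Cb_cnj) blast+
    show "F z t = g t * z t" for z t
      by (simp add: F g_def elem_op_def ip_def sum_distrib_right sum_distrib_left mult_ac)
  qed
qed

text \<open>A finite ordinal is isolated, so its level is clopen and avoids the corner. This is the
  test function for evaluating operators at (\<open>None\<close>, \<open>enat n\<close>).\<close>

lemma C0_corner_space_indicator:
  "(\<lambda>(q, m). if q \<in> topspace (Alexandroff_compactification P) \<and> m = enat n then 1 else 0)
    \<in> C0 (corner_space P)" (is "?z \<in> _")
proof (rule C0_corner_spaceI)
  have "continuous_on UNIV (\<lambda>m. if m = enat n then 1 else (0 :: complex))"
    unfolding continuous_on_open_vimage[OF open_UNIV]
  proof (intro allI impI)
    fix B :: "complex set"
    have "(\<lambda>m. if m = enat n then 1 else (0 :: complex)) -` B \<inter> UNIV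
      = (if 1 \<in> B then {enat n} else {}) \<union> (if 0 \<in> B then - {enat n} else {})"
      by (auto split: if_splits)
    also have "open \<dots>"
      by (simp add: open_enat open_Compl)
    finally show "open ((\<lambda>m. if m = enat n then 1 else (0 :: complex)) -` B \<inter> UNIV)" .
  qed
  then have "continuous_map (full_product P) euclidean
      ((\<lambda>m. if m = enat n then 1 else (0 :: complex)) \<circ> snd)"
    by (intro continuous_map_compose[OF continuous_map_snd]) simp
  then show "continuous_map (full_product P) euclidean ?z"
    by (rule continuous_map_eq) auto
qed auto

lemma id_not_C0_compact_corner_space:
  fixes P :: "'p topology"
  assumes P: "class_K_IV P"
  shows "\<not> C0_compact_op (corner_space P) id"
proof
  let ?K = "corner_space P"
  assume "C0_compact_op ?K id"
  then obtain F where F: "F \<in> elem_op_span ?K" "C0_opnorm ?K (\<lambda>z t. id z t - F z t) < 1 / 2"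
    unfolding C0_compact_op_def by (meson half_gt_zero zero_less_one)
  obtain g where g: "g \<in> C0 ?K" "\<And>z t. F z t = g t * z t"
    using elem_op_span_multiplication[OF F(1)] by blast
  obtain C where C: "compactin ?K C" "\<forall>t\<in>topspace ?K - C. cmod (g t) < 1 / 2"
    using g(1) unfolding C0_def by (smt (verit) half_gt_zero mem_Collect_eq zero_less_one)
  obtain n where n: "(None, enat n) \<notin> C"
    using corner_space_leaves_compact[OF P C(1)] by blast
  let ?t = "(None, enat n) :: 'p option \<times> enat"
  have t: "?t \<in> topspace ?K"
    by (simp add: topspace_corner_space)
  then have ne: "topspace ?K \<noteq> {}" by blast
  define z :: "'p option \<times> enat \<Rightarrow> complex" where
    "z = (\<lambda>(q, m). if q \<in> topspace (Alexandroff_compactification P) \<and> m = enat n then 1 else 0)"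
  have "z \<in> C0 ?K"
    unfolding z_def by (rule C0_corner_space_indicator)
  moreover have "supnorm ?K z \<le> 1"
    by (intro supnorm_le ne) (auto simp: z_def)
  ultimately have z: "z \<in> C0_unit_ball ?K"
    by (simp add: C0_unit_ball_def)
  obtain B where B: "\<And>t. cmod (g t) \<le> B"
    using C0_bounded[OF g(1)] by blast
  \<comment> \<open>\<open>C0_opnorm\<close> is a real supremum; this bound ensures that it
    dominates the value at z.\<close>
  have "supnorm ?K (\<lambda>t. id w t - F w t) \<le> 1 + B" if w: "w \<in> C0_unit_ball ?K" for w
  proof (intro supnorm_le ne)
    fix s
    have "cmod (g s * w s) \<le> B * 1"
      unfolding norm_mult using B[of s] C0_unit_ball_cmod_le[OF w, of s]
      by (intro mult_mono) (auto intro: order_trans[OF norm_ge_zero])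
    then show "cmod (id w s - F w s) \<le> 1 + B"
      using norm_triangle_ineq4[of "w s" "g s * w s"] C0_unit_ball_cmod_le[OF w, of s]
      by (simp add: g(2))
  qed
  then have "bdd_above ((\<lambda>w. supnorm ?K (\<lambda>t. id w t - F w t)) ` C0_unit_ball ?K)"
    by (intro bdd_aboveI2)
  then have "supnorm ?K (\<lambda>t. id z t - F z t) \<le> C0_opnorm ?K (\<lambda>z t. id z t - F z t)"
    unfolding C0_opnorm_def using z by (intro cSUP_upper)
  moreover have "(\<lambda>t. id z t - F z t) \<in> C0 ?K"
    unfolding g(2) id_apply using \<open>z \<in> C0 ?K\<close> g(1) C0_subset_Cb
    by (intro C0_diff C0_mult_Cb) blast+
  then have "cmod (id z ?t - F z ?t) \<le> supnorm ?K (\<lambda>t. id z t - F z t)"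
    using C0_cmod_le_supnorm[of "\<lambda>t. id z t - F z t" ?K ?t] t by simp
  \<comment> \<open>At this point z is 1, so g lies within 1/2 of 1 although its modulus is below
    1/2 off C; the triangle inequality excludes this.\<close>
  ultimately have "cmod (1 - g ?t) < 1 / 2"
    using F(2) by (simp add: g(2) z_def)
  moreover have "cmod (g ?t) < 1 / 2"
    using C(2) n t by blast
  ultimately show False
    using norm_triangle_ineq[of "1 - g ?t" "g ?t"] by simp
qed

theorem theorem2p16:
  fixes P :: "'p topology"
  assumes "class_K_IV P"
  shows "Cb_C0_totally_bounded (corner_space P) (C0_unit_ball (corner_space P)) \<and>
         Cb_C0_totally_bounded (corner_space P) (id ` C0_unit_ball (corner_space P)) \<and>
         \<not> C0_compact_op (corner_space P) id"
proof -
  have "topspace (corner_space P) \<noteq> {}"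
    by (auto simp: topspace_corner_space)
  then have "Cb_C0_totally_bounded (corner_space P) (C0_unit_ball (corner_space P))"
    using corner_space_uniform_tails[OF assms]
    by (intro unit_ball_totally_bounded_if_uniform_tails) auto
  then show ?thesis
    using id_not_C0_compact_corner_space[OF assms] by simp
qed

end
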